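(* Let $G$ be a directed graph on $V=\{s,t\}\cup\mathcal{V}$ with non-negative capacities $c_{uv}$, and let $\mathcal{V}_1,\mathcal{V}_2\subseteq\mathcal{V}$ with $\mathcal{V}_1\cup\mathcal{V}_2=\mathcal{V}$, $\mathcal{V}_1\cap\mathcal{V}_2\ne\varnothing$, such that every edge $(i,j)$ with $i,j\in\mathcal{V}$ and $c_{ij}>0$ has both endpoints in $\mathcal{V}_1$ or both in $\mathcal{V}_2$. Run the following procedure for $K\ge1$ iterations. Splitting: $G_r^{(1)}$ ($r=1,2$) is the graph on $\{s,t\}\cup\mathcal{V}_r$ whose capacity on $(u,v)$ is $\tfrac12c_{uv}$ if $u,v\in\{s,t\}\cup(\mathcal{V}_1\cap\mathcal{V}_2)$ and $c_{uv}$ otherwise. Iteration $m=1,\dots,K$: (a) on each $G_r^{(m)}$ an augmenting path maxflow computation pushes a total flow $\mathrm{F}_r^{(m)}$ from $s$ to $t$ (each push along a path decreases forward arc capacities and increases the corresponding backward arc capacities by the pushed amount), giving the residual graph $G_r^{(m')}$; (b) given dual variables $\boldsymbol\lambda^{(m)},\boldsymbol\lambda^{(m+1)}\in\mathbb{R}^{\mathcal{V}_1\cap\mathcal{V}_2}$ and $\triangle\lambda_i^{(m+1)}=\lambda_i^{(m+1)}-\lambda_i^{(m)}$, $G_1^{(m+1)}$ is obtained from $G_1^{(m')}$ by increasing the capacity of $(s,i)$ by $\triangle\lambda_i^{(m+1)}$ for each $i\in\mathcal{V}_1\cap\mathcal{V}_2$, and $G_2^{(m+1)}$ is obtained from $G_2^{(m')}$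 by increasing the capacity of $(i,t)$ by $\triangle\lambda_i^{(m+1)}$ for each $i\in\mathcal{V}_1\cap\mathcal{V}_2$. Merging: $G'$ is the graph on $\{s,t\}\cup\mathcal{V}$ in which an edge with both endpoints in $\{s,t\}\cup(\mathcal{V}_1\cap\mathcal{V}_2)$ has capacity equal to the sum of its capacities in $G_1^{(K+1)}$ and $G_2^{(K+1)}$, and every other edge has its capacity from the one of $G_1^{(K+1)},G_2^{(K+1)}$ containing it. Then for all $\mathbf{x}_\mathcal{V}$, $$f^{G}(\mathbf{x}_\mathcal{V})=f^{G'}(\mathbf{x}_\mathcal{V})+\sum_{m=1}^{K}\mathrm{F}_1^{(m)}+\sum_{m=1}^{K}\mathrm{F}_2^{(m)},$$ i.e. $f^{G'}$ and $f^G$ differ only in their constant terms, by the total flow pushed in the two subgraphs over the $K$ iterations.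
   Context: For a directed graph $H$ on $\{s,t\}\cup W$ with capacities $c_{uv}$ (absent edges have capacity $0$), its restricted homogeneous posiform is $\phi^H_h(\mathbf{x}_W)=\sum_{i\in W}c_{si}x_i+\sum_{i\in W}c_{it}(1-x_i)+\sum_{i\ne j\in W}c_{ij}(1-x_i)x_j$ for $\mathbf{x}_W\in\{0,1\}^W$, which gives the $s$-$t$ cut cost (up to an $\mathbf{x}$-independent constant) with $x_i=0$ meaning $i$ is on the source side. The multi-linear polynomial $f^H$ of $H$ is the unique polynomial $l+\sum_{i}l_ix_i+\sum_{\{i,j\},\,i\ne j}l_{ij}x_ix_j$ agreeing with $\phi^H_h$ on $\{0,1\}^W$.
   Formalization: The displayed identity fails in general; the proved one also subtracts Σ_i(λ_i^(K+1)−λ_i^(1)) over V_1∩V_2 and c_st−c'_st (c' = capacity in G'). The displayed form is obtained when c_st=0 and Σ_iλ_i^(K+1)=Σ_iλ_i^(1). *)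

theory Defs
  imports Complex_Main
begin

text \<open>
  A graph on the vertices \<open>{s, t} \<union> W\<close> is given by \<open>s\<close>, \<open>t\<close>, \<open>W\<close> and its capacities
  \<open>c u v\<close>, with capacity \<open>0\<close> for absent edges. Capacities of arbitrary sign are allowed, since the
  updates of the dual variables may make a capacity negative.
\<close>

type_synonym 'a capacity = "'a \<Rightarrow> 'a \<Rightarrow> real"

text \<open>The capacity \<open>c s t\<close> does not occur: it contributes only a constant to the cost of a cut.\<close>

definition posiform :: "'a \<Rightarrow> 'a \<Rightarrow> 'a set \<Rightarrow> 'a capacity \<Rightarrow> ('a \<Rightarrow> real) \<Rightarrow> real" where
  "posiform s t W c x =
     (\<Sum>i\<in>W. c s i * x i) + (\<Sum>i\<in>W. c i t * (1 - x i))
     + (\<Sum>i\<in>W. \<Sum>j\<in>W - {i}. c i j * (1 - x i) * x j)"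

text \<open>The coefficient of \<open>x\<^sub>i x\<^sub>j\<close> is \<open>mlp_quad p {i, j}\<close>.\<close>

datatype 'a mlp = MLP (mlp_const: real) (mlp_lin: "'a \<Rightarrow> real") (mlp_quad: "'a set \<Rightarrow> real")

definition pairs :: "'a set \<Rightarrow> 'a set set" where
  "pairs W = {e. e \<subseteq> W \<and> card e = 2}"

definition mlp_eval :: "'a set \<Rightarrow> 'a mlp \<Rightarrow> ('a \<Rightarrow> real) \<Rightarrow> real" where
  "mlp_eval W p x =
     mlp_const p + (\<Sum>i\<in>W. mlp_lin p i * x i) + (\<Sum>e\<in>pairs W. mlp_quad p e * (\<Prod>i\<in>e. x i))"

definition mlp_in :: "'a set \<Rightarrow> 'a mlp \<Rightarrow> bool" where
  "mlp_in W p \<longleftrightarrow> (\<forall>i. i \<notin> W \<longrightarrow> mlp_lin p i = 0) \<and> (\<forall>e. e \<notin> pairs W \<longrightarrow> mlp_quad p e = 0)"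

definition mlp_of_graph :: "'a \<Rightarrow> 'a \<Rightarrow> 'a set \<Rightarrow> 'a capacity \<Rightarrow> 'a mlp" where
  "mlp_of_graph s t W c =
     (THE p. mlp_in W p \<and>
        (\<forall>x. (\<forall>i\<in>W. x i \<in> {0, 1}) \<longrightarrow> mlp_eval W p x = posiform s t W c x))"

definition arcs :: "'a list \<Rightarrow> ('a \<times> 'a) set" where
  "arcs p = set (zip p (tl p))"

definition st_path :: "'a \<Rightarrow> 'a \<Rightarrow> 'a set \<Rightarrow> 'a list \<Rightarrow> bool" where
  "st_path s t W p \<longleftrightarrow>
     p \<noteq> [] \<and> hd p = s \<and> last p = t \<and> distinct p \<and> set p \<subseteq> {s, t} \<union> W"

definition augmenting :: "'a \<Rightarrow> 'a \<Rightarrow> 'a set \<Rightarrow> 'a capacity \<Rightarrow> 'a list \<Rightarrow> real \<Rightarrow> bool" where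
  "augmenting s t W c p d \<longleftrightarrow> st_path s t W p \<and> 0 < d \<and> (\<forall>(u, v)\<in>arcs p. d \<le> c u v)"

definition push :: "'a capacity \<Rightarrow> 'a list \<Rightarrow> real \<Rightarrow> 'a capacity" where
  "push c p d = (\<lambda>u v. c u v - (if (u, v) \<in> arcs p then d else 0)
                            + (if (v, u) \<in> arcs p then d else 0))"

text \<open>
  \<open>pushes s t W c F c'\<close>: finitely many pushes along augmenting paths, of total amount \<open>F\<close>,
  turn the capacities \<open>c\<close> into the residual capacities \<open>c'\<close>.
\<close>

inductive pushes :: "'a \<Rightarrow> 'a \<Rightarrow> 'a set \<Rightarrow> 'a capacity \<Rightarrow> real \<Rightarrow> 'a capacity \<Rightarrow> bool"
  for s t W c where
  pushes_none: "pushes s t W c 0 c"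
| pushes_step: "pushes s t W c F c' \<Longrightarrow> augmenting s t W c' p d
                \<Longrightarrow> pushes s t W c (F + d) (push c' p d)"

definition maxflow_run :: "'a \<Rightarrow> 'a \<Rightarrow> 'a set \<Rightarrow> 'a capacity \<Rightarrow> real \<Rightarrow> 'a capacity \<Rightarrow> bool" where
  "maxflow_run s t W c F c' \<longleftrightarrow>
     pushes s t W c F c' \<and> \<not> (\<exists>p d. augmenting s t W c' p d)"

text \<open>
  In the following, \<open>I\<close> is the common part of the two inner vertex sets and \<open>W\<close> is one of
  these sets.
\<close>

definition split_cap :: "'a \<Rightarrow> 'a \<Rightarrow> 'a set \<Rightarrow> 'a set \<Rightarrow> 'a capacity \<Rightarrow> 'a capacity" where
  "split_cap s t I W c = (\<lambda>u v.
     if u \<in> {s, t} \<union> I \<and> v \<in> {s, t} \<union> I then c u v / 2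
     else if u \<in> {s, t} \<union> W \<and> v \<in> {s, t} \<union> W then c u v
     else 0)"

definition raise_source :: "'a \<Rightarrow> 'a set \<Rightarrow> ('a \<Rightarrow> real) \<Rightarrow> 'a capacity \<Rightarrow> 'a capacity" where
  "raise_source s I \<delta> c = (\<lambda>u v. if u = s \<and> v \<in> I then c u v + \<delta> v else c u v)"

definition raise_sink :: "'a \<Rightarrow> 'a set \<Rightarrow> ('a \<Rightarrow> real) \<Rightarrow> 'a capacity \<Rightarrow> 'a capacity" where
  "raise_sink t I \<delta> c = (\<lambda>u v. if u \<in> I \<and> v = t then c u v + \<delta> u else c u v)"

definition merge_cap ::
  "'a \<Rightarrow> 'a \<Rightarrow> 'a set \<Rightarrow> 'a set \<Rightarrow> 'a capacity \<Rightarrow> 'a capacity \<Rightarrow> 'a capacity" where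
  "merge_cap s t V1 V2 c1 c2 = (\<lambda>u v.
     if u \<in> {s, t} \<union> (V1 \<inter> V2) \<and> v \<in> {s, t} \<union> (V1 \<inter> V2) then c1 u v + c2 u v
     else if u \<in> {s, t} \<union> V1 \<and> v \<in> {s, t} \<union> V1 then c1 u v
     else if u \<in> {s, t} \<union> V2 \<and> v \<in> {s, t} \<union> V2 then c2 u v
     else 0)"

lemma finite_pairs: "finite W \<Longrightarrow> finite (pairs W)"
  by (simp add: pairs_def)

lemma posiform_eq_mlp_eval:
  assumes "finite W"
  shows "posiform s t W c x = mlp_eval W
    (MLP (\<Sum>i\<in>W. c i t)
      (\<lambda>i. if i \<in> W then c s i - c i t + (\<Sum>j\<in>W - {i}. c j i) else 0)
      (\<lambda>e. if e \<in> pairs W then - (\<Sum>(i, j) | i \<in> W \<and> j \<in> W \<and> i \<noteq> j \<and> {i, j} = e. c i j) else 0)) x"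
proof -
  let ?P = "SIGMA i:W. W - {i}"
  have finP: "finite ?P" using assms by auto
  have swap: "(\<Sum>i\<in>W. \<Sum>j\<in>W - {i}. c i j * x j) = (\<Sum>i\<in>W. (\<Sum>j\<in>W - {i}. c j i) * x i)"
  proof -
    have "(\<Sum>i\<in>W. \<Sum>j\<in>W - {i}. c i j * x j) = (\<Sum>(i, j)\<in>?P. c i j * x j)"
      using assms by (subst sum.Sigma) auto
    also have "\<dots> = (\<Sum>(i, j)\<in>?P. c j i * x i)"
      by (rule sum.reindex_bij_witness[where i = "\<lambda>(a, b). (b, a)" and j = "\<lambda>(a, b). (b, a)"]) auto
    also have "\<dots> = (\<Sum>i\<in>W. \<Sum>j\<in>W - {i}. c j i * x i)"
      using assms by (subst sum.Sigma) auto
    finally show ?thesis by (simp add: sum_distrib_right)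
  qed
  have quad: "(\<Sum>e\<in>pairs W. (\<Sum>(i, j) | i \<in> W \<and> j \<in> W \<and> i \<noteq> j \<and> {i, j} = e. c i j) * (\<Prod>i\<in>e. x i))
      = (\<Sum>i\<in>W. \<Sum>j\<in>W - {i}. c i j * x i * x j)"
  proof -
    have "(\<Sum>i\<in>W. \<Sum>j\<in>W - {i}. c i j * x i * x j) = (\<Sum>q\<in>?P. c (fst q) (snd q) * x (fst q) * x (snd q))"
      using assms by (subst sum.Sigma) (auto simp: case_prod_beta)
    also have "\<dots> = (\<Sum>e\<in>pairs W. \<Sum>q | q \<in> ?P \<and> {fst q, snd q} = e. c (fst q) (snd q) * x (fst q) * x (snd q))"
      by (rule sum.group[symmetric]) (use finP finite_pairs[OF assms] in \<open>auto simp: pairs_def\<close>)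
    also have "\<dots> = (\<Sum>e\<in>pairs W. (\<Sum>(i, j) | i \<in> W \<and> j \<in> W \<and> i \<noteq> j \<and> {i, j} = e. c i j) * (\<Prod>i\<in>e. x i))"
    proof (rule sum.cong[OF refl])
      fix e assume "e \<in> pairs W"
      have "(\<Sum>(i, j) | i \<in> W \<and> j \<in> W \<and> i \<noteq> j \<and> {i, j} = e. c i j) * (\<Prod>i\<in>e. x i)
          = (\<Sum>q | q \<in> ?P \<and> {fst q, snd q} = e. c (fst q) (snd q) * (\<Prod>i\<in>e. x i))"
        unfolding sum_distrib_right by (rule sum.cong) auto
      also have "\<dots> = (\<Sum>q | q \<in> ?P \<and> {fst q, snd q} = e. c (fst q) (snd q) * x (fst q) * x (snd q))"
        by (rule sum.cong) auto
      finally show "(\<Sum>q | q \<in> ?P \<and> {fst q, snd q} = e. c (fst q) (snd q) * x (fst q) * x (snd q))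
          = (\<Sum>(i, j) | i \<in> W \<and> j \<in> W \<and> i \<noteq> j \<and> {i, j} = e. c i j) * (\<Prod>i\<in>e. x i)" by simp
    qed
    finally show ?thesis by simp
  qed
  have "mlp_eval W
    (MLP (\<Sum>i\<in>W. c i t)
      (\<lambda>i. if i \<in> W then c s i - c i t + (\<Sum>j\<in>W - {i}. c j i) else 0)
      (\<lambda>e. if e \<in> pairs W then - (\<Sum>(i, j) | i \<in> W \<and> j \<in> W \<and> i \<noteq> j \<and> {i, j} = e. c i j) else 0)) x
    = (\<Sum>i\<in>W. c i t) + (\<Sum>i\<in>W. (c s i - c i t + (\<Sum>j\<in>W - {i}. c j i)) * x i)
      - (\<Sum>e\<in>pairs W. (\<Sum>(i, j) | i \<in> W \<and> j \<in> W \<and> i \<noteq> j \<and> {i, j} = e. c i j) * (\<Prod>i\<in>e. x i))"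
    by (simp add: mlp_eval_def sum_negf)
  also have "\<dots> = posiform s t W c x"
    unfolding quad posiform_def
    by (simp add: algebra_simps sum.distrib sum_subtractf swap[simplified algebra_simps])
  finally show ?thesis by simp
qed

lemma mlp_eq_if_eval_eq:
  assumes "finite W" "mlp_in W p" "mlp_in W q"
    and eq: "\<And>x. \<forall>i\<in>W. x i \<in> {0, 1} \<Longrightarrow> mlp_eval W p x = mlp_eval W q x"
  shows "p = q"
proof -
  define X :: "'a set \<Rightarrow> 'a \<Rightarrow> real" where "X A i = (if i \<in> A then 1 else 0)" for A i
  have X: "mlp_eval W r (X A) =
      mlp_const r + (\<Sum>i\<in>A. mlp_lin r i) + (\<Sum>e\<in>pairs A. mlp_quad r e)" if "A \<subseteq> W" for r A
  proof -
    have "(\<Sum>i\<in>W. mlp_lin r i * X A i) = (\<Sum>i\<in>A. mlp_lin r i)"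
      using assms(1) that by (intro sum.mono_neutral_cong_right) (auto simp: X_def)
    moreover have "(\<Sum>e\<in>pairs W. mlp_quad r e * (\<Prod>i\<in>e. X A i)) = (\<Sum>e\<in>pairs A. mlp_quad r e)"
    proof (rule sum.mono_neutral_cong_right)
      show "\<forall>e\<in>pairs W - pairs A. mlp_quad r e * (\<Prod>i\<in>e. X A i) = 0"
      proof
        fix e assume e: "e \<in> pairs W - pairs A"
        then have "finite e" "\<exists>i\<in>e. X A i = 0"
          using assms(1) by (auto simp: pairs_def X_def intro: finite_subset)
        then show "mlp_quad r e * (\<Prod>i\<in>e. X A i) = 0" by (simp add: prod_zero)
      qed
      show "mlp_quad r e * (\<Prod>i\<in>e. X A i) = mlp_quad r e" if "e \<in> pairs A" for e
        using that by (auto simp: pairs_def X_def subset_iff)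
    qed (use assms(1) that finite_pairs in \<open>auto simp: pairs_def\<close>)
    ultimately show ?thesis by (simp add: mlp_eval_def)
  qed
  have eqX: "mlp_const p + (\<Sum>i\<in>A. mlp_lin p i) + (\<Sum>e\<in>pairs A. mlp_quad p e) =
      mlp_const q + (\<Sum>i\<in>A. mlp_lin q i) + (\<Sum>e\<in>pairs A. mlp_quad q e)" if "A \<subseteq> W" for A
    using eq[of "X A"] X[OF that] by (simp add: X_def)
  have p0: "pairs {} = {}" by (auto simp: pairs_def)
  have p1: "pairs {i} = {}" for i :: 'a
    by (auto simp: pairs_def card_2_iff)
  have p2: "pairs {i, j} = {{i, j}}" if "i \<noteq> j" for i j :: 'a
    using that by (auto simp: pairs_def card_2_iff doubleton_eq_iff)
  have const: "mlp_const p = mlp_const q"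
    using eqX[of "{}"] by (simp add: p0)
  have lin: "mlp_lin p i = mlp_lin q i" for i
    using eqX[of "{i}"] assms(2,3) const by (cases "i \<in> W") (auto simp: p1 mlp_in_def)
  have "mlp_quad p e = mlp_quad q e" for e
  proof (cases "e \<in> pairs W")
    case True
    then obtain i j where "e = {i, j}" "i \<noteq> j" "e \<subseteq> W" by (auto simp: pairs_def card_2_iff)
    with eqX[of e] const lin show ?thesis by (simp add: p2)
  qed (use assms(2,3) in \<open>auto simp: mlp_in_def\<close>)
  with const lin show ?thesis by (intro mlp.expand) auto
qed

lemma ex1_mlp_of_graph:
  assumes "finite W"
  shows "\<exists>!p. mlp_in W p \<and>
    (\<forall>x. (\<forall>i\<in>W. x i \<in> {0, 1}) \<longrightarrow> mlp_eval W p x = posiform s t W c x)"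
proof (rule ex_ex1I)
  show "\<exists>p. mlp_in W p \<and>
    (\<forall>x. (\<forall>i\<in>W. x i \<in> {0, 1}) \<longrightarrow> mlp_eval W p x = posiform s t W c x)"
    by (rule exI, rule conjI[rotated], rule allI, rule impI,
        rule posiform_eq_mlp_eval[OF assms, symmetric]) (simp add: mlp_in_def)
qed (use mlp_eq_if_eval_eq[OF assms] in auto)

end

theory Submission imports Defs begin

text \<open>
  For a 0/1 labelling, extended by \<open>0\<close> at \<open>s\<close> and \<open>1\<close> at \<open>t\<close>, the posiform plus \<open>c s t\<close> is the cut
  cost \<open>\<Sum>\<^sub>u\<^sub>v c u v (1 - x u) x v\<close>, which is linear in the capacities. Pushing \<open>d\<close> along a path changes
  this cost by \<open>d \<Sum> (x u - x v)\<close> over the arcs of the path, which telescopes to \<open>-d\<close>. The cut cost of the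
  merged graph is the sum of those of the two parts, and the two updates by \<open>\<delta>\<close> together add
  \<open>\<Sum> \<delta>\<^sub>i x\<^sub>i + \<Sum> \<delta>\<^sub>i (1 - x\<^sub>i) = \<Sum> \<delta>\<^sub>i\<close>, which does not depend on the labelling.
\<close>

section \<open>Cut costs and their relation to the posiform\<close>

definition cut_cost :: "'a set \<Rightarrow> 'a capacity \<Rightarrow> ('a \<Rightarrow> real) \<Rightarrow> real" where
  "cut_cost U c x = (\<Sum>u\<in>U. \<Sum>v\<in>U. c u v * (1 - x u) * x v)"

lemma cut_cost_cong:
  assumes "\<And>u v. u \<in> U \<Longrightarrow> v \<in> U \<Longrightarrow> c u v = c' u v"
  shows "cut_cost U c x = cut_cost U c' x"
  unfolding cut_cost_def using assms by (intro sum.cong) auto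

text \<open>Arcs into \<open>s\<close> carry the factor \<open>x s = 0\<close> and arcs out of
  \<open>t\<close> the factor \<open>1 - x t = 0\<close>. The diagonal terms vanish because a 0/1
  value gives \<open>(1 - x i) * x i = 0\<close>. Of the arcs between terminals only
  \<open>(s, t)\<close> survives, and the posiform omits it.\<close>

lemma posiform_eq_cut_cost:
  assumes "finite W" "s \<noteq> t" "s \<notin> W" "t \<notin> W" "x s = 0" "x t = 1" "\<forall>i\<in>W. x i \<in> {0, 1}"
  shows "posiform s t W c x + c s t = cut_cost ({s, t} \<union> W) c x"
proof -
  have diag: "(\<Sum>j\<in>W - {i}. c i j * (1 - x i) * x j) = (\<Sum>j\<in>W. c i j * (1 - x i) * x j)"
    if "i \<in> W" for i
    using assms that by (intro sum.mono_neutral_left) auto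
  show ?thesis
    unfolding posiform_def cut_cost_def
    using assms by (simp add: diag sum.distrib)
qed

section \<open>Pushing flow along paths\<close>

lemma arcs_subset: "arcs p \<subseteq> set p \<times> set p"
  unfolding arcs_def by (cases p) (auto dest: set_zip_leftD set_zip_rightD)

lemma arcs_Cons_Cons: "arcs (a # b # p) = insert (a, b) (arcs (b # p))"
  by (simp add: arcs_def)

lemma finite_arcs: "finite (arcs p)"
  by (simp add: arcs_def)

lemma sum_arcs_telescope:
  fixes f :: "'a \<Rightarrow> real"
  assumes "p \<noteq> []" "distinct p"
  shows "(\<Sum>(u, v)\<in>arcs p. f u - f v) = f (hd p) - f (last p)"
  using assms
proof (induction p rule: induct_list012)
  case (2 a)
  then show ?case by (simp add: arcs_def)
next
  case (3 a b p)
  \<comment> \<open>\<open>arcs\<close> yields a set, so a repeated arc would be counted once only;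
    distinctness of the vertices excludes this, since \<open>a\<close> does not recur.\<close>
  have "(a, b) \<notin> arcs (b # p)"
    using arcs_subset[of "b # p"] 3 by auto
  with 3 show ?case by (simp add: arcs_Cons_Cons finite_arcs)
qed simp

lemma cut_cost_push:
  assumes "finite U" "set p \<subseteq> U" "p \<noteq> []" "distinct p"
  shows "cut_cost U (push c p d) x = cut_cost U c x + d * (x (hd p) - x (last p))"
proof -
  let ?A = "arcs p" and ?w = "\<lambda>u v. (1 - x u) * x v"
  have sub: "?A \<subseteq> U \<times> U" using arcs_subset[of p] assms(2) by blast
  have fwd: "(\<Sum>u\<in>U. \<Sum>v\<in>U. (if (u, v) \<in> ?A then d else 0) * g u v) = (\<Sum>(u, v)\<in>?A. d * g u v)"
    for g :: "'a \<Rightarrow> 'a \<Rightarrow> real"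
    unfolding sum.cartesian_product
    using sub assms(1) by (intro sum.mono_neutral_cong_right) auto
  have bwd: "(\<Sum>u\<in>U. \<Sum>v\<in>U. (if (v, u) \<in> ?A then d else 0) * ?w u v) = (\<Sum>(u, v)\<in>?A. d * ?w v u)"
    by (subst sum.swap) (rule fwd)
  have "cut_cost U (push c p d) x = cut_cost U c x
      - (\<Sum>u\<in>U. \<Sum>v\<in>U. (if (u, v) \<in> ?A then d else 0) * ?w u v)
      + (\<Sum>u\<in>U. \<Sum>v\<in>U. (if (v, u) \<in> ?A then d else 0) * ?w u v)"
    unfolding cut_cost_def push_def
    by (simp only: sum_subtractf[symmetric] sum.distrib[symmetric])
       (intro sum.cong refl, simp only: algebra_simps)
  \<comment> \<open>The products \<open>x u * x v\<close> cancel between an arc and its reverse: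
    \<open>(1 - x v) * x u - (1 - x u) * x v = x u - x v\<close>. Hence no 0/1 condition is required
    here.\<close>
  also have "\<dots> = cut_cost U c x + d * (\<Sum>(u, v)\<in>?A. x u - x v)"
    unfolding fwd bwd sum_distrib_left
    by (simp add: case_prod_beta sum_subtractf sum.distrib algebra_simps)
  finally show ?thesis using sum_arcs_telescope[OF assms(3,4)] by simp
qed

lemma cut_cost_pushes:
  assumes "pushes s t W c F c'" "finite W" "x s = 0" "x t = 1"
  shows "cut_cost ({s, t} \<union> W) c' x = cut_cost ({s, t} \<union> W) c x - F"
  using assms(1)
proof induction
  case (pushes_step F c' p d)
  then have p: "p \<noteq> []" "distinct p" "set p \<subseteq> {s, t} \<union> W" "hd p = s" "last p = t"
    by (auto simp: augmenting_def st_path_def)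
  show ?case
    using cut_cost_push[OF _ p(3,1,2)] pushes_step.IH p assms by simp
qed simp

text \<open>A push through \<open>(s, t)\<close> would need \<open>0 < d \<le> c' s t = 0\<close>,
  and a simple path starting at \<open>s\<close> never re-enters \<open>s\<close>, so it cannot
  raise the capacity of \<open>(s, t)\<close> through the reverse arc either.\<close>

lemma pushes_preserve_zero_st:
  assumes "pushes s t W c F c'" "c s t = 0"
  shows "c' s t = 0"
  using assms
proof induction
  case (pushes_step F c' p d)
  then have p: "p \<noteq> []" "distinct p" "hd p = s" "d > 0" "\<forall>(u, v)\<in>arcs p. d \<le> c' u v"
    by (auto simp: augmenting_def st_path_def)
  have "(s, t) \<notin> arcs p" using p pushes_step by auto
  moreover have "(t, s) \<notin> arcs p"
    using p by (cases p) (auto simp: arcs_def dest: set_zip_rightD)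
  ultimately show ?case using pushes_step by (simp add: push_def)
qed simp

section \<open>Updates of the dual variables\<close>

lemma cut_cost_raise_source:
  assumes "finite U" "s \<in> U" "I \<subseteq> U" "x s = 0"
  shows "cut_cost U (raise_source s I \<delta> c) x = cut_cost U c x + (\<Sum>i\<in>I. \<delta> i * x i)"
proof -
  have "cut_cost U (raise_source s I \<delta> c) x =
      cut_cost U c x + (\<Sum>u\<in>U. if u = s then \<Sum>v\<in>U. if v \<in> I then \<delta> v * x v else 0 else 0)"
    unfolding cut_cost_def raise_source_def sum.distrib[symmetric]
    using assms(4) by (intro sum.cong refl) (auto simp: sum.distrib[symmetric] algebra_simps intro!: sum.cong)
  also have "\<dots> = cut_cost U c x + (\<Sum>i\<in>I. \<delta> i * x i)"
    using assms by (simp add: sum.If_cases Int_absorb1)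
  finally show ?thesis .
qed

lemma cut_cost_raise_sink:
  assumes "finite U" "t \<in> U" "I \<subseteq> U" "x t = 1"
  shows "cut_cost U (raise_sink t I \<delta> c) x = cut_cost U c x + (\<Sum>i\<in>I. \<delta> i * (1 - x i))"
proof -
  have "cut_cost U (raise_sink t I \<delta> c) x =
      cut_cost U c x + (\<Sum>u\<in>U. \<Sum>v\<in>U. if v = t then if u \<in> I then \<delta> u * (1 - x u) else 0 else 0)"
    unfolding cut_cost_def raise_sink_def sum.distrib[symmetric]
    using assms(4) by (intro sum.cong refl) (auto simp: algebra_simps)
  also have "\<dots> = cut_cost U c x + (\<Sum>i\<in>I. \<delta> i * (1 - x i))"
    using assms by (simp add: sum.If_cases Int_absorb1)
  finally show ?thesis .
qed

section \<open>Merging and splitting\<close>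

lemma cut_cost_restrict:
  assumes "finite U" "W \<subseteq> U"
  shows "cut_cost U (\<lambda>u v. if u \<in> W \<and> v \<in> W then c u v else 0) x = cut_cost W c x"
  unfolding cut_cost_def sum.cartesian_product
  using assms by (intro sum.mono_neutral_cong_right) (auto split: if_splits dest: finite_subset)

lemma cut_cost_add:
  "cut_cost U (\<lambda>u v. c u v + c' u v) x = cut_cost U c x + cut_cost U c' x"
  unfolding cut_cost_def sum.distrib[symmetric] by (simp add: distrib_right)

lemma cut_cost_merge:
  assumes "finite (V1 \<union> V2)"
  shows "cut_cost ({s, t} \<union> (V1 \<union> V2)) (merge_cap s t V1 V2 c1 c2) x =
    cut_cost ({s, t} \<union> V1) c1 x + cut_cost ({s, t} \<union> V2) c2 x"
proof -
  \<comment> \<open>The shared vertices are exactly the intersection of the two vertex sets, so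
    merging is addition of the two capacities extended by \<open>0\<close>.\<close>
  have "merge_cap s t V1 V2 c1 c2 = (\<lambda>u v.
      (if u \<in> {s, t} \<union> V1 \<and> v \<in> {s, t} \<union> V1 then c1 u v else 0)
      + (if u \<in> {s, t} \<union> V2 \<and> v \<in> {s, t} \<union> V2 then c2 u v else 0))"
    unfolding merge_cap_def by (intro ext) auto
  then show ?thesis
    using assms by (simp only: cut_cost_add) (intro arg_cong2[where f = "(+)"] cut_cost_restrict; auto)
qed

text \<open>On shared pairs the two halves add up. A pair contained in neither part gets
  \<open>0\<close> from the merge, which is right because no edge of \<open>c\<close> joins the two
  parts outside their overlap.\<close>

lemma merge_split_cap:
  assumes "\<forall>i\<in>V1 \<union> V2. \<forall>j\<in>V1 \<union> V2. c i j \<noteq> 0 \<longrightarrow> i \<in> V1 \<and> j \<in> V1 \<or> i \<in> V2 \<and> j \<in> V2"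
    and "u \<in> {s, t} \<union> (V1 \<union> V2)" "v \<in> {s, t} \<union> (V1 \<union> V2)"
  shows "merge_cap s t V1 V2 (split_cap s t (V1 \<inter> V2) V1 c) (split_cap s t (V1 \<inter> V2) V2 c) u v = c u v"
  using assms unfolding merge_cap_def split_cap_def by auto

section \<open>From posiforms to polynomials\<close>

lemma mlp_of_graph_props:
  assumes "finite W"
  shows "mlp_in W (mlp_of_graph s t W c)"
    and "\<forall>i\<in>W. x i \<in> {0, 1} \<Longrightarrow> mlp_eval W (mlp_of_graph s t W c) x = posiform s t W c x"
  using theI'[OF ex1_mlp_of_graph[OF assms, of s t c]] unfolding mlp_of_graph_def by auto

text \<open>By uniqueness of the multi-linear form, agreement up to \<open>D\<close> at 0/1 points
  already fixes all coefficients; this is what carries the result to arbitrary real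
  arguments.\<close>

lemma mlp_of_graph_shift:
  assumes "finite W"
    and "\<And>x. \<forall>i\<in>W. x i \<in> {0, 1} \<Longrightarrow> posiform s t W c x = posiform s t W c' x + D"
  shows "mlp_of_graph s t W c = MLP (mlp_const (mlp_of_graph s t W c') + D)
    (mlp_lin (mlp_of_graph s t W c')) (mlp_quad (mlp_of_graph s t W c'))" (is "_ = ?q")
proof (rule mlp_eq_if_eval_eq[OF assms(1)])
  show "mlp_in W (mlp_of_graph s t W c)" "mlp_in W ?q"
    using mlp_of_graph_props(1)[OF assms(1)] by (auto simp: mlp_in_def)
  show "mlp_eval W (mlp_of_graph s t W c) x = mlp_eval W ?q x" if "\<forall>i\<in>W. x i \<in> {0, 1}" for x
  proof -
    have "mlp_eval W ?q x = mlp_eval W (mlp_of_graph s t W c') x + D"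
      by (simp add: mlp_eval_def)
    then show ?thesis
      using mlp_of_graph_props(2)[OF assms(1) that] assms(2)[OF that] by simp
  qed
qed

lemma posiform_cong:
  assumes "\<And>i. i \<in> W \<Longrightarrow> x i = y i"
  shows "posiform s t W c x = posiform s t W c y"
  unfolding posiform_def using assms by simp

text \<open>Two corrections accompany the flow: the total dual change, which the updates add to the
  cut cost, and \<open>c s t - c' s t\<close>, since flow sent directly from \<open>s\<close> to
  \<open>t\<close> is invisible to the posiform. The last conjunct gives a case in which both
  vanish.\<close>

theorem theorem2:
  fixes s t :: 'a
    and V V1 V2 :: "'a set"
    and c c' :: "'a capacity"
    and c1 c2 r1 r2 :: "nat \<Rightarrow> 'a capacity"
    and F1 F2 :: "nat \<Rightarrow> real"
    and lam :: "nat \<Rightarrow> 'a \<Rightarrow> real"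
    and K :: nat
  assumes "finite V" and "s \<noteq> t" and "s \<notin> V" and "t \<notin> V"
    and "\<forall>u\<in>{s, t} \<union> V. \<forall>v\<in>{s, t} \<union> V. 0 \<le> c u v"
    and "V1 \<union> V2 = V" and "V1 \<inter> V2 \<noteq> {}"
    and "\<forall>i\<in>V. \<forall>j\<in>V. 0 < c i j \<longrightarrow> i \<in> V1 \<and> j \<in> V1 \<or> i \<in> V2 \<and> j \<in> V2"
    and "1 \<le> K"
    and "c1 1 = split_cap s t (V1 \<inter> V2) V1 c"
    and "c2 1 = split_cap s t (V1 \<inter> V2) V2 c"
    and "\<forall>m\<in>{1..K}. maxflow_run s t V1 (c1 m) (F1 m) (r1 m)"
    and "\<forall>m\<in>{1..K}. maxflow_run s t V2 (c2 m) (F2 m) (r2 m)"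
    and "\<forall>m\<in>{1..K}. c1 (m + 1) =
           raise_source s (V1 \<inter> V2) (\<lambda>i. lam (m + 1) i - lam m i) (r1 m)"
    and "\<forall>m\<in>{1..K}. c2 (m + 1) =
           raise_sink t (V1 \<inter> V2) (\<lambda>i. lam (m + 1) i - lam m i) (r2 m)"
    and "c' = merge_cap s t V1 V2 (c1 (K + 1)) (c2 (K + 1))"
  shows "(\<forall>x. mlp_eval V (mlp_of_graph s t V c) x =
            mlp_eval V (mlp_of_graph s t V c') x + (\<Sum>m=1..K. F1 m) + (\<Sum>m=1..K. F2 m)
            - (\<Sum>i\<in>V1 \<inter> V2. lam (K + 1) i - lam 1 i) - (c s t - c' s t))
       \<and> mlp_lin (mlp_of_graph s t V c) = mlp_lin (mlp_of_graph s t V c')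
       \<and> mlp_quad (mlp_of_graph s t V c) = mlp_quad (mlp_of_graph s t V c')
       \<and> (c s t = 0 \<and> (\<Sum>i\<in>V1 \<inter> V2. lam (K + 1) i) = (\<Sum>i\<in>V1 \<inter> V2. lam 1 i) \<longrightarrow>
           (\<forall>x. mlp_eval V (mlp_of_graph s t V c) x =
              mlp_eval V (mlp_of_graph s t V c') x + (\<Sum>m=1..K. F1 m) + (\<Sum>m=1..K. F2 m)))"
proof -
  let ?I = "V1 \<inter> V2" and ?U1 = "{s, t} \<union> V1" and ?U2 = "{s, t} \<union> V2" and ?U = "{s, t} \<union> V"
  let ?D = "(\<Sum>m=1..K. F1 m) + (\<Sum>m=1..K. F2 m)
    - (\<Sum>i\<in>?I. lam (K + 1) i - lam 1 i) - (c s t - c' s t)"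
  have fin: "finite V1" "finite V2" and V: "V = V1 \<union> V2" using assms by auto
  have p1: "pushes s t V1 (c1 m) (F1 m) (r1 m)" and p2: "pushes s t V2 (c2 m) (F2 m) (r2 m)"
    if "m \<in> {1..K}" for m
    using assms(12,13) that by (auto simp: maxflow_run_def)
  \<comment> \<open>Invariant after \<open>n\<close> complete iterations, whose outcome has index
    \<open>n + 1\<close>.\<close>
  have inv: "cut_cost ?U1 (c1 (n + 1)) x + cut_cost ?U2 (c2 (n + 1)) x =
      cut_cost ?U1 (c1 1) x + cut_cost ?U2 (c2 1) x
      - (\<Sum>m=1..n. F1 m) - (\<Sum>m=1..n. F2 m) + (\<Sum>i\<in>?I. lam (n + 1) i - lam 1 i)"
    if "n \<le> K" "x s = 0" "x t = 1" for n x
    using that(1)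
  proof (induction n)
    case (Suc n)
    then have m: "Suc n \<in> {1..K}" by simp
    let ?\<delta> = "\<lambda>i. lam (Suc n + 1) i - lam (Suc n) i"
    have "cut_cost ?U1 (c1 (Suc n + 1)) x =
        cut_cost ?U1 (c1 (Suc n)) x - F1 (Suc n) + (\<Sum>i\<in>?I. ?\<delta> i * x i)"
      unfolding assms(14)[rule_format, OF m] cut_cost_pushes[OF p1[OF m] fin(1) that(2,3), symmetric]
      by (rule cut_cost_raise_source) (use fin that in \<open>auto\<close>)
    moreover have "cut_cost ?U2 (c2 (Suc n + 1)) x =
        cut_cost ?U2 (c2 (Suc n)) x - F2 (Suc n) + (\<Sum>i\<in>?I. ?\<delta> i * (1 - x i))"
      unfolding assms(15)[rule_format, OF m] cut_cost_pushes[OF p2[OF m] fin(2) that(2,3), symmetric]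
      by (rule cut_cost_raise_sink) (use fin that in \<open>auto\<close>)
    moreover have "(\<Sum>i\<in>?I. ?\<delta> i * x i) + (\<Sum>i\<in>?I. ?\<delta> i * (1 - x i)) = (\<Sum>i\<in>?I. ?\<delta> i)"
      unfolding sum.distrib[symmetric] by (intro sum.cong refl) (simp add: algebra_simps)
    moreover have "(\<Sum>i\<in>?I. lam (Suc n + 1) i - lam 1 i) =
        (\<Sum>i\<in>?I. ?\<delta> i) + (\<Sum>i\<in>?I. lam (Suc n) i - lam 1 i)"
      unfolding sum.distrib[symmetric] by (intro sum.cong refl) simp
    ultimately show ?case using Suc by simp
  qed simp
  \<comment> \<open>Non-negativity of \<open>c\<close> turns \<open>c i j \<noteq> 0\<close> into
    \<open>0 < c i j\<close>.\<close>
  have nz: "\<forall>i\<in>V1 \<union> V2. \<forall>j\<in>V1 \<union> V2. c i j \<noteq> 0 \<longrightarrow> i \<in> V1 \<and> j \<in> V1 \<or> i \<in> V2 \<and> j \<in> V2"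
    using assms(5,8) unfolding V by (metis UnCI order_less_le)
  have posi: "posiform s t V c x = posiform s t V c' x + ?D" if x: "\<forall>i\<in>V. x i \<in> {0, 1}" for x
  proof -
    \<comment> \<open>The values of \<open>x\<close> at the terminals are arbitrary; resetting them
      leaves the posiform unchanged, as it reads \<open>x\<close> on \<open>V\<close> only.\<close>
    define y where "y = x(s := 0, t := 1)"
    have y: "y s = 0" "y t = 1" "\<forall>i\<in>V. y i \<in> {0, 1}" and xy: "\<And>i. i \<in> V \<Longrightarrow> x i = y i"
      using assms(2-4) x by (auto simp: y_def)
    have "cut_cost ?U c y = cut_cost ?U1 (c1 1) y + cut_cost ?U2 (c2 1) y"
      unfolding assms(10,11) V using fin
      by (subst cut_cost_merge[symmetric], simp)
         (rule cut_cost_cong, rule merge_split_cap[OF nz, symmetric])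
    moreover have "cut_cost ?U c' y = cut_cost ?U1 (c1 (K + 1)) y + cut_cost ?U2 (c2 (K + 1)) y"
      unfolding assms(16) V using fin by (intro cut_cost_merge) simp
    ultimately have "cut_cost ?U c y = cut_cost ?U c' y
        + (\<Sum>m=1..K. F1 m) + (\<Sum>m=1..K. F2 m) - (\<Sum>i\<in>?I. lam (K + 1) i - lam 1 i)"
      using inv[OF order_refl y(1,2)] by linarith
    then show ?thesis
      using posiform_eq_cut_cost[OF assms(1-4) y, of c] posiform_eq_cut_cost[OF assms(1-4) y, of c']
        posiform_cong[OF xy, where s = s and t = t] by simp
  qed
  have shift: "mlp_of_graph s t V c = MLP (mlp_const (mlp_of_graph s t V c') + ?D)
      (mlp_lin (mlp_of_graph s t V c')) (mlp_quad (mlp_of_graph s t V c'))"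
    by (rule mlp_of_graph_shift[OF assms(1)]) (rule posi)
  have eval: "mlp_eval V (mlp_of_graph s t V c) x = mlp_eval V (mlp_of_graph s t V c') x + ?D" for x
    unfolding shift by (simp add: mlp_eval_def)
  have st: "c' s t = 0" if "c s t = 0"
  proof -
    have "c1 (n + 1) s t = 0 \<and> c2 (n + 1) s t = 0" if "n \<le> K" for n
      using that
    proof (induction n)
      case 0
      then show ?case using assms(10,11) \<open>c s t = 0\<close> by (simp add: split_cap_def)
    next
      case (Suc n)
      then have m: "Suc n \<in> {1..K}" by simp
      have "r1 (Suc n) s t = 0" "r2 (Suc n) s t = 0"
        using pushes_preserve_zero_st[OF p1[OF m]] pushes_preserve_zero_st[OF p2[OF m]] Suc by auto
      \<comment> \<open>The dual updates touch only arcs between a terminal and a shared inner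
        vertex, never \<open>(s, t)\<close>.\<close>
      then show ?case
        using assms(14,15) m assms(3,4) V by (auto simp: raise_source_def raise_sink_def)
    qed
    from this[OF order_refl] show ?thesis by (simp add: assms(16) merge_cap_def)
  qed
  show ?thesis
  proof (intro conjI allI impI)
    fix x
    show "mlp_eval V (mlp_of_graph s t V c) x =
        mlp_eval V (mlp_of_graph s t V c') x + (\<Sum>m=1..K. F1 m) + (\<Sum>m=1..K. F2 m)
        - (\<Sum>i\<in>?I. lam (K + 1) i - lam 1 i) - (c s t - c' s t)"
      using eval[of x] by simp
    show "mlp_lin (mlp_of_graph s t V c) = mlp_lin (mlp_of_graph s t V c')"
      "mlp_quad (mlp_of_graph s t V c) = mlp_quad (mlp_of_graph s t V c')"
      unfolding shift by simp_all
    assume "c s t = 0 \<and> (\<Sum>i\<in>?I. lam (K + 1) i) = (\<Sum>i\<in>?I. lam 1 i)"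
    then show "mlp_eval V (mlp_of_graph s t V c) x =
        mlp_eval V (mlp_of_graph s t V c') x + (\<Sum>m=1..K. F1 m) + (\<Sum>m=1..K. F2 m)"
      using eval[of x] st by (simp add: sum_subtractf)
  qed
qed

end
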